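(* Let $X=\{x\in\mathbb R^n: Ax\le a\}$ be a nonempty compact polyhedral set with $A\in\mathbb R^{m\times n}$, $a\in\mathbb R^m$, and let $V$ be its set of vertices. Let $\emptyset\ne U\subseteq V$ and $c\in\mathbb R^n$. If there exists $z\in\mathbb R^n$ such that $A_{I(U)}z\le 0$ and $\langle c,z\rangle>0$, then $$\max_{p\in V,\,u\in U}\langle c,p-u\rangle\ \ge\ \frac{\Omega_X}{|U|}\,\frac{\langle c,z\rangle}{\|z\|},$$ where $\Omega_X=\zeta/\varphi$ with $$\zeta=\min_{v\in V,\ i\in\{1,\dots,m\}:\ a_i>A_iv}(a_i-A_iv),\qquad \varphi=\max_{i\in\{1,\dots,m\}\setminus I(V)}\|A_i\|.$$
   Context: $\|\cdot\|$ is the Euclidean norm. $A_i$ denotes the $i$th row of $A$, and for an index set $I\subseteq\{1,\dots,m\}$, $A_I$ is the submatrix of $A$ consisting of the rows with index in $I$. For a set $U\subseteq X$, $I(U)=\{i\in\{1,\dots,m\}: A_iv=a_i\ \ \forall v\in U\}$ is the set of constraints active at all points of $U$. Vertices are the same as extreme points. Vector inequalities are componentwise. *)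

theory Defs
  imports "HOL-Analysis.Analysis"
begin

text \<open>The order on vectors is the library's componentwise one.\<close>

definition feasible_set :: "real^'n^'m \<Rightarrow> real^'m \<Rightarrow> (real^'n) set" where
  "feasible_set A a = {x. A *v x \<le> a}"

definition vertices :: "(real^'n) set \<Rightarrow> (real^'n) set" where
  "vertices X = {v. v extreme_point_of X}"

definition active :: "real^'n^'m \<Rightarrow> real^'m \<Rightarrow> (real^'n) set \<Rightarrow> 'm set" where
  "active A a U = {i. \<forall>v\<in>U. row i A \<bullet> v = a $ i}"

text \<open>
  The constants below depend on the representation \<open>A\<close>, \<open>a\<close> and not only on the set
  it describes. \<open>V\<close> is finite for every polyhedral set; \<open>Min\<close> and \<open>Max\<close> are meaningful
  whenever some constraint is inactive at some vertex, i.e. \<open>active A a V \<noteq> UNIV\<close>.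
\<close>

definition zeta :: "real^'n^'m \<Rightarrow> real^'m \<Rightarrow> real" where
  "zeta A a = (let V = vertices (feasible_set A a) in
     Min {a $ i - row i A \<bullet> v | v i. v \<in> V \<and> a $ i > row i A \<bullet> v})"

definition phi :: "real^'n^'m \<Rightarrow> real^'m \<Rightarrow> real" where
  "phi A a = (let V = vertices (feasible_set A a) in
     Max {norm (row i A) | i. i \<in> UNIV - active A a V})"

definition Omega :: "real^'n^'m \<Rightarrow> real^'m \<Rightarrow> real" where
  "Omega A a = zeta A a / phi A a"

end

theory Submission
  imports Defs
begin

text \<open>
  The barycenter of \<open>U\<close> has slack at least \<open>\<zeta> / |U|\<close> in every constraint that is not active
  on \<open>U\<close>, so one can move from it along \<open>z\<close> by a length of \<open>\<Omega>\<^sub>X / |U|\<close> without leaving \<open>X\<close>.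
  The linear functional \<open>c\<close> is at least as large at some vertex as at the point reached, and at
  most as large at some point of \<open>U\<close> as at the barycenter.
\<close>

lemma mem_feasible_set_iff: "x \<in> feasible_set A a \<longleftrightarrow> (\<forall>i. row i A \<bullet> x \<le> a $ i)"
  by (simp add: feasible_set_def less_eq_vec_def matrix_vector_mul_component row_def)

lemma polyhedron_feasible_set: "polyhedron (feasible_set A a)"
proof -
  have "feasible_set A a = (\<Inter>i. {x. row i A \<bullet> x \<le> a $ i})"
    by (auto simp: mem_feasible_set_iff)
  then show ?thesis
    by (auto intro!: polyhedron_Inter polyhedron_halfspace_le)
qed

lemma finite_vertices_feasible_set: "finite (vertices (feasible_set A a))"
  unfolding vertices_def by (intro finite_polyhedron_extreme_points polyhedron_feasible_set)

lemma vertices_subset: "vertices X \<subseteq> X"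
  by (auto simp: vertices_def extreme_point_of_def)

text \<open>Otherwise the open half-space \<open>{y. c \<bullet> y < c \<bullet> x}\<close> would
  contain \<open>S\<close>, hence, being convex, also the hull of \<open>S\<close>, and so
  \<open>x\<close> itself.\<close>

lemma convex_hull_inner_le:
  fixes c :: "'a::real_inner"
  assumes "x \<in> convex hull S"
  shows "\<exists>p\<in>S. c \<bullet> x \<le> c \<bullet> p"
proof (rule ccontr)
  assume "\<not> ?thesis"
  then have "S \<subseteq> {y. c \<bullet> y < c \<bullet> x}"
    by force
  then have "convex hull S \<subseteq> {y. c \<bullet> y < c \<bullet> x}"
    by (intro hull_minimal convex_halfspace_lt)
  with assms show False
    by blast
qed

lemma barycenter_in_convex_hull:
  assumes "finite U" "U \<noteq> {}"
  shows "(1 / real (card U)) *\<^sub>R \<Sum>U \<in> convex hull U"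
proof -
  have "(\<Sum>u\<in>U. (1 / real (card U)) *\<^sub>R u) \<in> convex hull U"
    using assms by (intro convex_sum) (auto simp: hull_inc)
  then show ?thesis
    by (simp add: scaleR_sum_right)
qed

text \<open>If every \<open>row i A \<bullet> z\<close> were at most 0, the whole ray from
  \<open>x\<close> along \<open>z\<close> would stay feasible, which boundedness forbids. In the
  theorem this yields a constraint outside \<open>active A a U\<close>, because moving along
  \<open>z\<close> increases no constraint in that set.\<close>

lemma compact_no_recession_direction:
  fixes A :: "real^'n^'m"
  assumes "compact (feasible_set A a)" "x \<in> feasible_set A a" "z \<noteq> 0"
  shows "\<exists>i. row i A \<bullet> z > 0"
proof (rule ccontr)
  assume "\<not> ?thesis"
  then have le: "row i A \<bullet> z \<le> 0" for i
    by (simp add: not_less)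
  have feas: "x + t *\<^sub>R z \<in> feasible_set A a" if "t \<ge> 0" for t
    unfolding mem_feasible_set_iff
  proof
    fix i
    show "row i A \<bullet> (x + t *\<^sub>R z) \<le> a $ i"
      using assms(2) mult_nonneg_nonpos[OF that le[of i]]
      by (auto simp: mem_feasible_set_iff inner_add_right intro: order_trans[rotated])
  qed
  obtain B where B: "norm y \<le> B" if "y \<in> feasible_set A a" for y
    using compact_imp_bounded[OF assms(1)] by (auto simp: bounded_iff)
  have "B \<ge> 0"
    using B[OF assms(2)] norm_ge_zero order_trans by blast
  \<comment> \<open>With this \<open>t\<close> the vector \<open>t *\<^sub>R z\<close> has norm
    \<open>B + norm x + 1\<close>. As the difference of \<open>x + t *\<^sub>R z\<close> and
    \<open>x\<close> it can have norm at most \<open>B + norm x\<close>.\<close>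
  define t where "t = (B + norm x + 1) / norm z"
  have "t \<ge> 0"
    using \<open>B \<ge> 0\<close> by (simp add: t_def)
  then have "norm (x + t *\<^sub>R z) \<le> B"
    by (intro B feas)
  moreover have "norm (t *\<^sub>R z) = B + norm x + 1"
    using assms(3) \<open>B \<ge> 0\<close> by (simp add: t_def)
  moreover have "norm (t *\<^sub>R z) \<le> norm (x + t *\<^sub>R z) + norm x"
    using norm_triangle_ineq4[of "x + t *\<^sub>R z" x] by simp
  ultimately show False
    by linarith
qed

context
  fixes A :: "real^'n^'m" and a :: "real^'m" and V :: "(real^'n) set"
  assumes V_def: "V = vertices (feasible_set A a)"
begin

lemma slack_finite: "finite {a $ i - row i A \<bullet> v | v i. v \<in> V \<and> a $ i > row i A \<bullet> v}"
proof (rule finite_subset)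
  show "{a $ i - row i A \<bullet> v | v i. v \<in> V \<and> a $ i > row i A \<bullet> v}
      \<subseteq> (\<lambda>(v, i). a $ i - row i A \<bullet> v) ` (V \<times> UNIV)"
    by auto
qed (simp add: V_def finite_vertices_feasible_set)

lemma zeta_le: "v \<in> V \<Longrightarrow> a $ i > row i A \<bullet> v \<Longrightarrow> zeta A a \<le> a $ i - row i A \<bullet> v"
  unfolding zeta_def Let_def V_def[symmetric] by (intro Min_le slack_finite) auto

text \<open>The hypotheses make the set under \<open>Min\<close> nonempty, so the minimum is
  attained and is one of the positive slacks.\<close>

lemma zeta_pos:
  assumes "v \<in> V" "a $ i > row i A \<bullet> v"
  shows "zeta A a > 0"
proof -
  have "zeta A a \<in> {a $ i - row i A \<bullet> v | v i. v \<in> V \<and> a $ i > row i A \<bullet> v}"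
    unfolding zeta_def Let_def V_def[symmetric] using assms by (intro Min_in slack_finite) auto
  then show ?thesis
    by auto
qed

lemma norm_row_le_phi: "i \<notin> active A a V \<Longrightarrow> norm (row i A) \<le> phi A a"
  unfolding phi_def Let_def V_def[symmetric] by (intro Max_ge) auto

end

text \<open>The slack is affine, so at the barycenter it is the average of the slacks over
  \<open>U\<close>. All of these are nonnegative, and the one at \<open>u0\<close> is at least
  \<open>zeta A a\<close>.\<close>

lemma slack_barycenter:
  fixes A :: "real^'n^'m"
  assumes V: "V = vertices (feasible_set A a)" and "U \<subseteq> V"
    and u0: "u0 \<in> U" "a $ i > row i A \<bullet> u0"
  shows "zeta A a / real (card U) \<le> a $ i - row i A \<bullet> ((1 / real (card U)) *\<^sub>R \<Sum>U)"
proof -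
  have fin: "finite U"
    using assms finite_subset finite_vertices_feasible_set by blast
  then have n: "real (card U) > 0"
    using u0 by (auto simp: card_gt_0_iff)
  have "zeta A a \<le> a $ i - row i A \<bullet> u0"
    using assms by (intro zeta_le[OF V]) auto
  also have "\<dots> \<le> (\<Sum>u\<in>U. a $ i - row i A \<bullet> u)"
  proof (rule member_le_sum[OF u0(1) _ fin])
    fix u assume "u \<in> U - {u0}"
    then have "u \<in> feasible_set A a"
      using V \<open>U \<subseteq> V\<close> vertices_subset by blast
    then show "0 \<le> a $ i - row i A \<bullet> u"
      by (simp add: mem_feasible_set_iff)
  qed
  also have "\<dots> = real (card U) * a $ i - row i A \<bullet> \<Sum>U"
    by (simp add: sum_subtractf inner_sum_right)
  finally show ?thesis
    using n by (simp add: field_simps)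
qed

theorem lemma3p1:
  fixes A :: "real^'n^'m" and a :: "real^'m" and c z :: "real^'n"
    and X V U :: "(real^'n) set"
  assumes X_def: "X = feasible_set A a"
    and "X \<noteq> {}" and "compact X"
    and V_def: "V = vertices X"
    and "U \<noteq> {}" and "U \<subseteq> V"
    and "\<forall>i\<in>active A a U. row i A \<bullet> z \<le> 0" and "c \<bullet> z > 0"
  shows "Max {c \<bullet> (p - u) | p u. p \<in> V \<and> u \<in> U}
           \<ge> Omega A a / real (card U) * (c \<bullet> z / norm z)"
proof -
  have V: "V = vertices (feasible_set A a)"
    using V_def X_def by simp
  have finV: "finite V"
    using V finite_vertices_feasible_set by blast
  then have finU: "finite U"
    using \<open>U \<subseteq> V\<close> finite_subset by blast
  define n where "n = real (card U)"
  have n: "n > 0"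
    using finU \<open>U \<noteq> {}\<close> by (simp add: n_def card_gt_0_iff)
  have "V \<subseteq> X"
    using V_def vertices_subset by blast
  have convX: "convex X"
    using X_def polyhedron_feasible_set polyhedron_imp_convex by blast
  \<comment> \<open>Krein-Milman: this places the barycenter in \<open>X\<close> and later lets a
    vertex dominate the point reached.\<close>
  have hullV: "X = convex hull V"
    using Krein_Milman_Minkowski[OF \<open>compact X\<close> convX] by (simp add: V_def vertices_def)
  have z: "z \<noteq> 0"
    using \<open>c \<bullet> z > 0\<close> by auto
  have finM: "finite {c \<bullet> (p - u) | p u. p \<in> V \<and> u \<in> U}"
    by (rule finite_subset[of _ "(\<lambda>(p, u). c \<bullet> (p - u)) ` (V \<times> U)"]) (auto simp: finV finU)
  have Max_ge': "c \<bullet> (p - u) \<le> Max {c \<bullet> (p - u) | p u. p \<in> V \<and> u \<in> U}"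
    if "p \<in> V" "u \<in> U" for p u
    using that by (intro Max_ge finM) auto
  \<comment> \<open>The first conjunct lets \<open>phi A a\<close> bound the row, the second lets
    \<open>zeta A a\<close> bound the slack; feasibility of \<open>u\<close> makes the inequality
    strict.\<close>
  have inactive: "i \<notin> active A a V \<and> (\<exists>u\<in>U. a $ i > row i A \<bullet> u)" if i: "i \<notin> active A a U" for i
  proof -
    obtain u where "u \<in> U" "row i A \<bullet> u \<noteq> a $ i"
      using i by (auto simp: active_def)
    moreover have "row i A \<bullet> u \<le> a $ i"
      using \<open>u \<in> U\<close> \<open>U \<subseteq> V\<close> \<open>V \<subseteq> X\<close> X_def mem_feasible_set_iff by blast
    ultimately show ?thesis
      using \<open>U \<subseteq> V\<close> unfolding active_def less_le by blast
  qed
  \<comment> \<open>Otherwise \<open>\<zeta>\<close> and \<open>\<phi>\<close> would be \<open>Min {}\<close> and \<open>Max {}\<close>.\<close>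
  obtain j where j: "j \<notin> active A a U"
    using compact_no_recession_direction[of A a _ z] \<open>compact X\<close> \<open>X \<noteq> {}\<close> z X_def assms(7)
    by (metis ex_in_conv not_less)
  have zeta: "zeta A a > 0"
    using inactive[OF j] zeta_pos[OF V] \<open>U \<subseteq> V\<close> by blast
  have "phi A a \<ge> 0"
    using norm_row_le_phi[OF V] inactive[OF j] norm_ge_zero order_trans by blast
  then consider "phi A a = 0" | "phi A a > 0"
    by linarith
  then show ?thesis
  proof cases
    case 1
    \<comment> \<open>Here \<open>Omega A a = \<zeta> / 0 = 0\<close>.\<close>
    obtain u where "u \<in> U"
      using \<open>U \<noteq> {}\<close> by blast
    \<comment> \<open>The pair \<open>p = u\<close> contributes the value 0 to the maximum.\<close>
    then show ?thesis
      using Max_ge'[of u u] \<open>U \<subseteq> V\<close> by (auto simp: 1 Omega_def)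
  next
    case 2
    define w where "w = (1 / n) *\<^sub>R \<Sum>U"
    \<comment> \<open>Normalised so that \<open>t *\<^sub>R z\<close> has length
      \<open>Omega A a / n\<close>.\<close>
    define t where "t = zeta A a / (phi A a * n * norm z)"
    have t: "t \<ge> 0"
      using zeta 2 n by (simp add: t_def)
    have w_hull: "w \<in> convex hull U"
      unfolding w_def n_def by (rule barycenter_in_convex_hull[OF finU \<open>U \<noteq> {}\<close>])
    then have "w \<in> X"
      using hullV hull_mono[OF \<open>U \<subseteq> V\<close>] by blast
    have "w + t *\<^sub>R z \<in> feasible_set A a"
      unfolding mem_feasible_set_iff
    proof
      fix i
      show "row i A \<bullet> (w + t *\<^sub>R z) \<le> a $ i"
      proof (cases "i \<in> active A a U")
        case True
        then have "t * (row i A \<bullet> z) \<le> 0"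
          using assms(7) t by (simp add: mult_nonneg_nonpos)
        moreover have "row i A \<bullet> w \<le> a $ i"
          using \<open>w \<in> X\<close> X_def mem_feasible_set_iff by blast
        ultimately show ?thesis
          by (simp add: inner_add_right)
      next
        case False
        \<comment> \<open>By Cauchy-Schwarz the step raises this constraint by at most
          \<open>t * (phi A a * norm z)\<close>, which is exactly the slack
          \<open>zeta A a / n\<close> guaranteed at \<open>w\<close>.\<close>
        have "row i A \<bullet> z \<le> norm (row i A) * norm z"
          by (rule norm_cauchy_schwarz)
        also have "\<dots> \<le> phi A a * norm z"
          using norm_row_le_phi[OF V] inactive[OF False] by (simp add: mult_right_mono)
        finally have "t * (row i A \<bullet> z) \<le> t * (phi A a * norm z)"
          using t by (rule mult_left_mono)
        also have "\<dots> = zeta A a / n"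
          using 2 z by (simp add: t_def)
        also have "\<dots> \<le> a $ i - row i A \<bullet> w"
          using inactive[OF False] slack_barycenter[OF V \<open>U \<subseteq> V\<close>] by (auto simp: w_def n_def)
        finally show ?thesis
          by (simp add: inner_add_right)
      qed
    qed
    then obtain p where p: "p \<in> V" "c \<bullet> (w + t *\<^sub>R z) \<le> c \<bullet> p"
      using convex_hull_inner_le hullV X_def by blast
    \<comment> \<open>Negating \<open>c\<close> turns the upper bound over the hull into a lower
      one.\<close>
    obtain u where u: "u \<in> U" "c \<bullet> u \<le> c \<bullet> w"
      using convex_hull_inner_le[OF w_hull, of "- c"] by auto
    have "Omega A a / n * (c \<bullet> z / norm z) = t * (c \<bullet> z)"
      by (simp add: Omega_def t_def)
    \<comment> \<open>The gain \<open>t * (c \<bullet> z)\<close> is the difference of the values of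
      \<open>c\<close> at \<open>w + t *\<^sub>R z\<close> and at \<open>w\<close>, which lie
      between those at \<open>u\<close> and \<open>p\<close>.\<close>
    also have "\<dots> \<le> c \<bullet> (p - u)"
      using p u by (simp add: inner_add_right inner_diff_right)
    also have "\<dots> \<le> Max {c \<bullet> (p - u) | p u. p \<in> V \<and> u \<in> U}"
      using p u by (intro Max_ge')
    finally show ?thesis
      by (simp add: n_def)
  qed
qed

end
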